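(* Let $A\in\mathbb{Z}^{d\times n}$ be an integral matrix such that $\operatorname{cone}(A)$ is pointed, and let $k\ge 1$ be an integer. (i) There exists a monomial ideal $I^k(A)\subset\mathbb{Q}[x_1,\dots,x_n]$ such that $$\mathrm{Sg}_{\ge k}(A)=\{A\lambda:\lambda\in E^k(A)\},$$ where $E^k(A)\subset\mathbb{Z}^n_{\ge 0}$ is the set of exponents of monomials in $I^k(A)$. (ii) The set $\mathrm{Sg}_{<k}(A)$ can be written as a finite union of translates of sets of the form $\{A\lambda:\lambda\in S\}$, where $S$ is a coordinate subspace of $\mathbb{Z}^n_{\ge 0}$ (different members of the union may use different $S$).
   Context: $\operatorname{cone}(A)\subset\mathbb{R}^d$ is the cone of nonnegative real linear combinations of the columns of $A$. For $b\in\mathbb{Z}^d$ let $P_A(b)=\{x\in\mathbb{R}^n: Ax=b,\ x\ge 0\}$. $\mathrm{Sg}_{\ge k}(A)$ (respectively $\mathrm{Sg}_{<k}(A)$) is the set of all $b\in\operatorname{cone}(A)\cap\mathbb{Z}^d$ such that $P_A(b)\cap\mathbb{Z}^n$ contains at least $k$ (respectively fewer than $k$) distinct points. With $e_1,\dots,e_n$ the standard basis vectors, a coordinate subspace of $\mathbb{Z}^n_{\ge 0}$ of dimension $r\ge1$ is a set $\{e_{i_1}z_1+\dots+e_{i_r}z_r: z_j\in\mathbb{Z}_{\ge 0}\}$ with $i_1<\dots<i_r$; the $0$-dimensional coordinate subspace is $\{0\}$. The zero ideal counts as a monomial ideal (with empty set of exponents). *)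

theory Defs
  imports "HOL-Analysis.Analysis" "HOL-Library.Poly_Mapping"
begin

definition of_int_vec :: "int ^ 'n \<Rightarrow> real ^ 'n" where
  "of_int_vec v = (\<chi> i. of_int (v $ i))"

definition of_int_mat :: "int ^ 'n ^ 'd \<Rightarrow> real ^ 'n ^ 'd" where
  "of_int_mat A = (\<chi> i j. of_int (A $ i $ j))"

definition of_nat_vec :: "nat ^ 'n \<Rightarrow> int ^ 'n" where
  "of_nat_vec v = (\<chi> i. of_nat (v $ i))"

definition cone_of :: "int ^ 'n ^ 'd \<Rightarrow> (real ^ 'd) set" where
  "cone_of A = {of_int_mat A *v x | x. \<forall>i. 0 \<le> x $ i}"

definition pointed :: "'a::real_vector set \<Rightarrow> bool" where
  "pointed C \<longleftrightarrow> C \<inter> uminus ` C = {0}"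

definition polyhedron_of :: "int ^ 'n ^ 'd \<Rightarrow> int ^ 'd \<Rightarrow> (real ^ 'n) set" where
  "polyhedron_of A b = {x. of_int_mat A *v x = of_int_vec b \<and> (\<forall>i. 0 \<le> x $ i)}"

definition lattice_points :: "int ^ 'n ^ 'd \<Rightarrow> int ^ 'd \<Rightarrow> (real ^ 'n) set" where
  "lattice_points A b = polyhedron_of A b \<inter> range of_int_vec"

(* The fibre is infinite e.g. when A has a zero column, and card is then 0. *)
definition Sg_ge :: "nat \<Rightarrow> int ^ 'n ^ 'd \<Rightarrow> (int ^ 'd) set" where
  "Sg_ge k A = {b. of_int_vec b \<in> cone_of A \<and>
     (infinite (lattice_points A b) \<or> k \<le> card (lattice_points A b))}"

(* This includes those b in the cone for which there is no lattice point at all. *)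
definition Sg_less :: "nat \<Rightarrow> int ^ 'n ^ 'd \<Rightarrow> (int ^ 'd) set" where
  "Sg_less k A = {b. of_int_vec b \<in> cone_of A \<and>
     finite (lattice_points A b) \<and> card (lattice_points A b) < k}"

(* The polynomial ring over Q in variables indexed by 'n, as the monoid algebra of the
   additive monoid of exponent vectors; the product is the convolution product. *)
type_synonym 'n rat_mpoly = "((nat, 'n) vec) \<Rightarrow>\<^sub>0 rat"

definition monomial :: "nat ^ 'n \<Rightarrow> ('n::finite) rat_mpoly" where
  "monomial a = Poly_Mapping.single a 1"

lemma module_times: "module ((*) :: 'a::comm_ring_1 \<Rightarrow> 'a \<Rightarrow> 'a)"
  by unfold_locales (simp_all add: algebra_simps)

(* An ideal is a submodule of the ring over itself, so the span is the ideal generated by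
   the given monomials; no generators give the zero ideal. *)
definition monomial_ideal :: "('n::finite) rat_mpoly set \<Rightarrow> bool" where
  "monomial_ideal I \<longleftrightarrow> (\<exists>M. I = module.span (*) (monomial ` M))"

definition exponents :: "('n::finite) rat_mpoly set \<Rightarrow> (nat ^ 'n) set" where
  "exponents I = {a. monomial a \<in> I}"

definition coordinate_subspace :: "(nat ^ 'n) set \<Rightarrow> bool" where
  "coordinate_subspace S \<longleftrightarrow>
     (\<exists>J. S = {\<Sum>j\<in>J. z j *s axis j 1 | z :: 'n \<Rightarrow> nat. True})"

definition matrix_image :: "int ^ 'n ^ 'd \<Rightarrow> (nat ^ 'n) set \<Rightarrow> (int ^ 'd) set" where
  "matrix_image A S = {A *v of_nat_vec l | l. l \<in> S}"

end

theory Submission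
  imports Defs
begin

text \<open>
  Having at least \<open>k\<close> lattice points in the fibre is inherited from \<open>b\<close> by \<open>b + A *v l\<close>, since
  translation by \<open>l\<close> embeds the one fibre into the other. Hence
  \<open>{l. b + A *v l \<in> Sg_ge k A}\<close> is closed upwards for every \<open>b\<close> in the cone. The case \<open>b = 0\<close>
  gives the ideal. For the second part, taking integer parts of the coefficients of a conic
  combination shows that the lattice points of the cone are covered by finitely many sets
  \<open>t + A \<nat>\<^sup>n\<close>. By Dickson's lemma, membership of \<open>l\<close> in an upward closed subset of \<open>\<nat>\<^sup>n\<close> depends
  only on \<open>min l m\<close> for a suitable \<open>m\<close>, so its complement is a finite union of fibres of
  \<open>l \<mapsto> min l m\<close>, each of which is a translated coordinate subspace.
\<close>

section \<open>Upward closed sets of exponent vectors\<close>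

lemma finite_vec_box:
  fixes S :: "'n::finite \<Rightarrow> 'a set"
  assumes "\<And>i. finite (S i)"
  shows "finite {v :: 'a ^ 'n. \<forall>i. v $ i \<in> S i}"
proof (rule finite_subset)
  show "{v :: 'a ^ 'n. \<forall>i. v $ i \<in> S i} \<subseteq> vec_lambda ` (PiE UNIV S)"
  proof
    fix v :: "'a ^ 'n" assume "v \<in> {v. \<forall>i. v $ i \<in> S i}"
    then have "(\<lambda>i. v $ i) \<in> PiE UNIV S" by auto
    then show "v \<in> vec_lambda ` (PiE UNIV S)"
      by (intro image_eqI[where x = "\<lambda>i. v $ i"]) simp_all
  qed
  show "finite (vec_lambda ` (PiE UNIV S))"
    using assms by (intro finite_imageI finite_PiE) auto
qed

section \<open>Dickson's lemma via monotone subsequences\<close>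

lemma nat_seq_incseq_subseq:
  fixes f :: "nat \<Rightarrow> nat"
  obtains r where "strict_mono r" "incseq (f \<circ> r)"
proof -
  obtain r where r: "strict_mono r" "monoseq (f \<circ> r)"
    using seq_monosub[of f] by (auto simp: comp_def)
  show thesis
  proof (cases "incseq (f \<circ> r)")
    case True
    with r show thesis by (rule_tac that)
  next
    case False
    with r have dec: "decseq (f \<circ> r)" by (auto simp: monoseq_iff)
    \<comment> \<open>A decreasing sequence of naturals is constant from any index where it attains
      its minimum, so its tail from there is also increasing.\<close>
    define n where "n = (ARG_MIN (f \<circ> r) n. True)"
    have min: "(f \<circ> r) n \<le> (f \<circ> r) i" for i
      unfolding n_def by (rule arg_min_nat_le) simp
    have "(f \<circ> r) (n + i) = (f \<circ> r) n" for i
      using decseqD[OF dec, of n "n + i"] min[of "n + i"] by simp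
    then have "incseq (f \<circ> (\<lambda>i. r (n + i)))" by (simp add: incseq_def)
    moreover have "strict_mono (\<lambda>i. r (n + i))" using r(1) by (simp add: strict_mono_def)
    ultimately show thesis by (rule_tac that)
  qed
qed

text \<open>Subsequences are extracted one coordinate at a time; monotonicity in the coordinates
  already treated survives further extraction.\<close>

lemma nat_vec_seq_incseq_subseq:
  fixes f :: "nat \<Rightarrow> nat ^ 'n"
  assumes "finite J"
  shows "\<exists>r. strict_mono r \<and> (\<forall>j\<in>J. incseq (\<lambda>i. f (r i) $ j))"
  using assms
proof (induction J rule: finite_induct)
  case empty
  show ?case by (rule exI[of _ id]) (simp add: strict_mono_def)
next
  case (insert j J)
  then obtain r where r: "strict_mono r" "\<forall>j\<in>J. incseq (\<lambda>i. f (r i) $ j)" by blast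
  obtain s where s: "strict_mono s" "incseq ((\<lambda>i. f (r i) $ j) \<circ> s)"
    by (rule nat_seq_incseq_subseq)
  have "incseq (\<lambda>i. f (r (s i)) $ j')" if "j' \<in> J" for j'
    using r(2) that s(1) by (auto simp: incseq_def strict_mono_less_eq)
  then show ?case using r(1) s
    by (intro exI[of _ "r \<circ> s"]) (auto simp: strict_mono_def comp_def)
qed

text \<open>An infinite antichain would contain an injective sequence, and a subsequence increasing
  in every coordinate would make two distinct members comparable.\<close>

lemma finite_antichain_nat_vec:
  fixes M :: "(nat ^ 'n::finite) set"
  assumes "\<And>a b. a \<in> M \<Longrightarrow> b \<in> M \<Longrightarrow> a \<le> b \<Longrightarrow> a = b"
  shows "finite M"
proof (rule ccontr)
  assume "infinite M"
  then obtain f :: "nat \<Rightarrow> nat ^ 'n" where f: "inj f" "range f \<subseteq> M"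
    using infinite_countable_subset by blast
  obtain r where r: "strict_mono r" "\<forall>j\<in>UNIV. incseq (\<lambda>i. f (r i) $ j)"
    using nat_vec_seq_incseq_subseq[of UNIV f] by auto
  have "f (r 0) \<le> f (r 1)" using r(2) by (simp add: less_eq_vec_def incseq_def)
  then have "f (r 0) = f (r 1)" using f(2) by (intro assms) auto
  then have "r 0 = r 1" using f(1) by (simp add: inj_eq)
  then show False using strict_monoD[OF r(1), of 0 1] by simp
qed

text \<open>Only finitely many vectors lie below \<open>l\<close>, so those in \<open>E\<close> have
  a minimal one. It is minimal in all of \<open>E\<close>, since anything below it is again below
  \<open>l\<close>.\<close>

lemma ex_minimal_nat_vec:
  fixes E :: "(nat ^ 'n::finite) set"
  assumes "l \<in> E"
  shows "\<exists>g\<in>E. g \<le> l \<and> (\<forall>h\<in>E. h \<le> g \<longrightarrow> h = g)"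
proof -
  define X where "X = {g \<in> E. g \<le> l}"
  have "finite {g. \<forall>i. g $ i \<in> {..l $ i}}" by (rule finite_vec_box) simp
  then have "finite X" by (rule rev_finite_subset) (auto simp: X_def less_eq_vec_def)
  moreover have "l \<in> X" using assms by (simp add: X_def)
  ultimately obtain g where g: "g \<in> X" "\<forall>h\<in>X. h \<le> g \<longrightarrow> g = h"
    using finite_has_minimal[of X] by auto
  have "h = g" if "h \<in> E" "h \<le> g" for h
  proof -
    have "h \<in> X" using that g(1) order_trans[of h g l] by (simp add: X_def)
    with g(2) that show ?thesis by blast
  qed
  with g(1) show ?thesis by (auto simp: X_def)
qed

text \<open>The minimal elements of \<open>E\<close> form an antichain, hence a finite set.\<close>

lemma dickson:
  fixes E :: "(nat ^ 'n::finite) set"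
  obtains G where "finite G" "G \<subseteq> E" "\<And>l. l \<in> E \<Longrightarrow> \<exists>g\<in>G. g \<le> l"
proof (rule that[of "{g \<in> E. \<forall>h\<in>E. h \<le> g \<longrightarrow> h = g}"])
  show "finite {g \<in> E. \<forall>h\<in>E. h \<le> g \<longrightarrow> h = g}" by (rule finite_antichain_nat_vec) auto
  show "\<exists>g\<in>{g \<in> E. \<forall>h\<in>E. h \<le> g \<longrightarrow> h = g}. g \<le> l" if "l \<in> E" for l
    using ex_minimal_nat_vec[OF that] by blast
qed blast

section \<open>Coordinate subspaces and truncation\<close>

definition supported_on :: "'n set \<Rightarrow> (nat ^ 'n) set" where
  "supported_on J = {l. \<forall>i. i \<notin> J \<longrightarrow> l $ i = 0}"

text \<open>Lets vanishing conditions on components replace the sums of basis vectors from here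
  on.\<close>

lemma coordinate_subspace_supported_on:
  fixes J :: "'n::finite set"
  shows "coordinate_subspace (supported_on J)"
proof -
  have comp: "(\<Sum>j\<in>J. z j *s axis j 1) $ i = (if i \<in> J then z i else 0)"
    for z :: "'n \<Rightarrow> nat" and i
  proof -
    have "(\<Sum>j\<in>J. z j *s axis j 1) $ i = (\<Sum>j\<in>J. if j = i then z j else 0)"
      unfolding sum_component by (rule sum.cong) (auto simp: axis_def)
    then show ?thesis by simp
  qed
  have "supported_on J = {\<Sum>j\<in>J. z j *s axis j 1 | z :: 'n \<Rightarrow> nat. True}"
  proof (intro equalityI subsetI)
    fix l assume "l \<in> supported_on J"
    then have "l = (\<Sum>j\<in>J. (l $ j) *s axis j 1)"
      unfolding vec_eq_iff comp by (auto simp: supported_on_def)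
    then show "l \<in> {\<Sum>j\<in>J. z j *s axis j 1 | z :: 'n \<Rightarrow> nat. True}" by auto
  next
    fix l assume "l \<in> {\<Sum>j\<in>J. z j *s axis j 1 | z :: 'n \<Rightarrow> nat. True}"
    then obtain z :: "'n \<Rightarrow> nat" where "l = (\<Sum>j\<in>J. z j *s axis j 1)" by blast
    then show "l \<in> supported_on J"
      unfolding supported_on_def by (simp only: mem_Collect_eq comp) simp
  qed
  then show ?thesis unfolding coordinate_subspace_def by blast
qed

definition truncate :: "nat \<Rightarrow> nat ^ 'n \<Rightarrow> nat ^ 'n" where
  "truncate m l = (\<chi> i. min (l $ i) m)"

lemma up_closed_truncate:
  fixes E :: "(nat ^ 'n::finite) set"
  assumes up: "\<And>l l'. l \<in> E \<Longrightarrow> l \<le> l' \<Longrightarrow> l' \<in> E"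
  obtains m where "\<And>l. truncate m l \<in> E \<longleftrightarrow> l \<in> E"
proof -
  obtain G where G: "finite G" "G \<subseteq> E" "\<And>l. l \<in> E \<Longrightarrow> \<exists>g\<in>G. g \<le> l"
    using dickson[of E] by blast
  \<comment> \<open>Any common bound for the entries of the generators would do: cutting
    \<open>l\<close> off at such a bound keeps it above every generator below
    \<open>l\<close>.\<close>
  define m where "m = (\<Sum>g\<in>G. \<Sum>i\<in>UNIV. g $ i)"
  have m: "g $ i \<le> m" if "g \<in> G" for g i
  proof -
    have "g $ i \<le> (\<Sum>i\<in>UNIV. g $ i)" by (rule member_le_sum) auto
    also have "\<dots> \<le> m" unfolding m_def using that G(1) by (intro member_le_sum) auto
    finally show ?thesis .
  qed
  have "truncate m l \<in> E" if "l \<in> E" for l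
  proof -
    obtain g where "g \<in> G" "g \<le> l" using G(3) \<open>l \<in> E\<close> by blast
    then have "g \<le> truncate m l" using m by (simp add: less_eq_vec_def truncate_def)
    with \<open>g \<in> G\<close> show ?thesis using G(2) up by blast
  qed
  moreover have "truncate m l \<le> l" for l by (simp add: less_eq_vec_def truncate_def)
  ultimately show thesis using up that by blast
qed

text \<open>An entry of the truncation below \<open>m\<close> determines the original entry, while
  an entry equal to \<open>m\<close> only says that the original is at least \<open>m\<close>. The
  saturated coordinates are therefore exactly the free ones.\<close>

lemma truncate_fibre:
  "{l. truncate m l = truncate m l0} =
   (+) (truncate m l0) ` supported_on {i. truncate m l0 $ i = m}"
proof (intro equalityI subsetI)
  fix l assume "l \<in> {l. truncate m l = truncate m l0}"
  then have l: "truncate m l0 = truncate m l" by simp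
  \<comment> \<open>Natural subtraction gives the excess over \<open>m\<close>, which is 0 wherever
    the entry is at most \<open>m\<close>.\<close>
  have "l = truncate m l + (\<chi> i. l $ i - m)" by (simp add: vec_eq_iff truncate_def min_def)
  moreover have "(\<chi> i. l $ i - m) \<in> supported_on {i. truncate m l $ i = m}"
    by (simp add: supported_on_def truncate_def)
  ultimately show "l \<in> (+) (truncate m l0) ` supported_on {i. truncate m l0 $ i = m}"
    unfolding l by (rule image_eqI)
next
  fix l assume "l \<in> (+) (truncate m l0) ` supported_on {i. truncate m l0 $ i = m}"
  then obtain s where s: "s \<in> supported_on {i. truncate m l0 $ i = m}" "l = truncate m l0 + s"
    by blast
  have "min (l $ i) m = min (l0 $ i) m" for i
    using s by (cases "min (l0 $ i) m = m") (auto simp: supported_on_def truncate_def)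
  then show "l \<in> {l. truncate m l = truncate m l0}" by (simp add: vec_eq_iff truncate_def)
qed

text \<open>The complement of \<open>D\<close> is closed upwards, so \<open>D\<close> is a union of
  fibres of \<open>truncate m\<close>; there are finitely many because truncated vectors lie in a
  box.\<close>

lemma down_closed_decomposition:
  fixes D :: "(nat ^ 'n::finite) set"
  assumes down: "\<And>l l'. l' \<in> D \<Longrightarrow> l \<le> l' \<Longrightarrow> l \<in> D"
  obtains G :: "((nat ^ 'n) \<times> (nat ^ 'n) set) set"
  where "finite G" "\<And>u S. (u, S) \<in> G \<Longrightarrow> coordinate_subspace S"
    "D = (\<Union>(u, S)\<in>G. (+) u ` S)"
proof -
  obtain m where "\<And>l. truncate m l \<in> - D \<longleftrightarrow> l \<in> - D"
    by (rule up_closed_truncate[of "- D"]) (use down in blast)+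
  then have m: "truncate m l \<in> D \<longleftrightarrow> l \<in> D" for l by simp
  define G where "G = (\<lambda>u. (u, supported_on {i. u $ i = m})) ` truncate m ` D"
  have "truncate m ` D \<subseteq> {v. \<forall>i. v $ i \<in> {..m}}" by (auto simp: truncate_def)
  then have "finite (truncate m ` D)" by (rule finite_subset) (rule finite_vec_box, simp)
  then have "finite G" by (simp add: G_def)
  moreover have "coordinate_subspace S" if "(u, S) \<in> G" for u S
    using that by (auto simp: G_def coordinate_subspace_supported_on)
  moreover have "D = (\<Union>(u, S)\<in>G. (+) u ` S)"
  proof -
    have "(\<Union>(u, S)\<in>G. (+) u ` S) = (\<Union>l0\<in>D. {l. truncate m l = truncate m l0})"
      by (simp add: G_def truncate_fibre)
    also have "\<dots> = D"
    proof (intro equalityI subsetI)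
      fix l assume "l \<in> (\<Union>l0\<in>D. {l. truncate m l = truncate m l0})"
      then obtain l0 where "l0 \<in> D" "truncate m l = truncate m l0" by blast
      then show "l \<in> D" using m[of l] m[of l0] by simp
    qed blast
    finally show ?thesis by simp
  qed
  ultimately show thesis by (rule that)
qed

section \<open>Monomial ideals\<close>

text \<open>Since \<open>E\<close> is closed upwards, the polynomials with all exponents in
  \<open>E\<close> form an ideal. It contains the generators, so their span acquires no monomial
  outside \<open>E\<close>.\<close>

lemma exponents_span_monomial:
  fixes E :: "(nat ^ 'n::finite) set"
  assumes up: "\<And>l l'. l \<in> E \<Longrightarrow> l \<le> l' \<Longrightarrow> l' \<in> E"
  shows "exponents (module.span (*) (monomial ` E)) = E"
proof -
  interpret module "(*) :: 'n rat_mpoly \<Rightarrow> 'n rat_mpoly \<Rightarrow> 'n rat_mpoly"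
    by (rule module_times)
  have "subspace {p :: 'n rat_mpoly. Poly_Mapping.keys p \<subseteq> E}"
  proof (rule subspaceI)
    fix p q :: "'n rat_mpoly"
    assume "p \<in> {p. Poly_Mapping.keys p \<subseteq> E}" "q \<in> {p. Poly_Mapping.keys p \<subseteq> E}"
    then show "p + q \<in> {p. Poly_Mapping.keys p \<subseteq> E}"
      using Poly_Mapping.keys_add[of p q] by auto
  next
    fix c p :: "'n rat_mpoly"
    assume p: "p \<in> {p. Poly_Mapping.keys p \<subseteq> E}"
    have "a + b \<in> E" if "b \<in> Poly_Mapping.keys p" for a b
    proof (rule up)
      show "b \<in> E" using p that by blast
    qed (simp add: less_eq_vec_def)
    then show "c * p \<in> {p. Poly_Mapping.keys p \<subseteq> E}"
      using keys_mult[of c p] by auto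
  qed simp
  then have "span (monomial ` E) \<subseteq> {p. Poly_Mapping.keys p \<subseteq> E}"
    by (intro span_minimal) (auto simp: monomial_def)
  moreover have "Poly_Mapping.keys (monomial a) = {a}" for a :: "nat ^ 'n"
    by (simp add: monomial_def)
  ultimately have "a \<in> E" if "monomial a \<in> span (monomial ` E)" for a
    using that by blast
  moreover have "monomial a \<in> span (monomial ` E)" if "a \<in> E" for a
    using that by (intro span_base imageI)
  ultimately show ?thesis unfolding exponents_def by blast
qed

section \<open>Lattice points in fibres and in the cone\<close>

lemma of_int_vec_add: "of_int_vec (u + v) = of_int_vec u + of_int_vec v"
  by (simp add: of_int_vec_def vec_eq_iff)

lemma of_int_vec_diff: "of_int_vec (u - v) = of_int_vec u - of_int_vec v"
  by (simp add: of_int_vec_def vec_eq_iff)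

lemma of_int_vec_mult: "of_int_vec (A *v v) = of_int_mat A *v of_int_vec v"
  by (simp add: of_int_vec_def of_int_mat_def vec_eq_iff matrix_vector_mult_def)

lemma of_int_vec_eq_iff: "of_int_vec u = of_int_vec v \<longleftrightarrow> u = v"
  by (simp add: of_int_vec_def vec_eq_iff)

lemma of_nat_vec_add: "of_nat_vec (u + v) = of_nat_vec u + of_nat_vec v"
  by (simp add: of_nat_vec_def vec_eq_iff)

lemma of_int_of_nat_vec_nonneg: "0 \<le> of_int_vec (of_nat_vec l) $ i"
  by (simp add: of_int_vec_def of_nat_vec_def)

text \<open>Passes from nonnegative integral points of a real polyhedron to vectors of
  naturals.\<close>

lemma lattice_points_nonempty_iff:
  "lattice_points A b \<noteq> {} \<longleftrightarrow> (\<exists>l. b = A *v of_nat_vec l)"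
proof
  assume "lattice_points A b \<noteq> {}"
  then obtain y where y: "of_int_vec y \<in> polyhedron_of A b" by (auto simp: lattice_points_def)
  then have "of_nat_vec (\<chi> i. nat (y $ i)) = y"
    by (simp add: of_nat_vec_def polyhedron_of_def vec_eq_iff of_int_vec_def)
  moreover have "b = A *v y"
    using y by (simp add: polyhedron_of_def flip: of_int_vec_mult of_int_vec_eq_iff)
  ultimately show "\<exists>l. b = A *v of_nat_vec l" by metis
next
  assume "\<exists>l. b = A *v of_nat_vec l"
  then obtain l where "b = A *v of_nat_vec l" by blast
  then have "of_int_vec (of_nat_vec l) \<in> lattice_points A b"
    by (simp add: lattice_points_def polyhedron_of_def of_int_vec_mult of_int_of_nat_vec_nonneg)
  then show "lattice_points A b \<noteq> {}" by blast
qed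

lemma cone_of_add:
  assumes "of_int_vec b \<in> cone_of A"
  shows "of_int_vec (b + A *v of_nat_vec l) \<in> cone_of A"
proof -
  obtain x where x: "of_int_vec b = of_int_mat A *v x" "\<forall>i. 0 \<le> x $ i"
    using assms by (auto simp: cone_of_def)
  have "of_int_vec (b + A *v of_nat_vec l) = of_int_mat A *v (x + of_int_vec (of_nat_vec l))"
    by (simp add: of_int_vec_add of_int_vec_mult x(1) matrix_vector_right_distrib)
  moreover have "\<forall>i. 0 \<le> (x + of_int_vec (of_nat_vec l)) $ i"
    using x(2) by (simp add: of_int_of_nat_vec_nonneg)
  ultimately show ?thesis unfolding cone_of_def by blast
qed

lemma lattice_points_translate:
  "(\<lambda>x. x + of_int_vec (of_nat_vec l)) ` lattice_points A b
    \<subseteq> lattice_points A (b + A *v of_nat_vec l)"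
proof safe
  fix x assume "x \<in> lattice_points A b"
  then obtain y where y: "x = of_int_vec y" "x \<in> polyhedron_of A b"
    by (auto simp: lattice_points_def)
  have "x + of_int_vec (of_nat_vec l) \<in> polyhedron_of A (b + A *v of_nat_vec l)"
    using y(2) by (simp add: polyhedron_of_def of_int_vec_add of_int_vec_mult
        matrix_vector_right_distrib of_int_of_nat_vec_nonneg)
  moreover have "x + of_int_vec (of_nat_vec l) = of_int_vec (y + of_nat_vec l)"
    by (simp add: y(1) of_int_vec_add)
  ultimately show "x + of_int_vec (of_nat_vec l) \<in> lattice_points A (b + A *v of_nat_vec l)"
    by (simp add: lattice_points_def)
qed

lemma Sg_ge_add:
  assumes "b \<in> Sg_ge k A"
  shows "b + A *v of_nat_vec l \<in> Sg_ge k A"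
proof -
  let ?f = "\<lambda>x. x + of_int_vec (of_nat_vec l)"
  let ?L = "lattice_points A b" and ?L' = "lattice_points A (b + A *v of_nat_vec l)"
  have inj: "inj_on ?f ?L" by (simp add: inj_on_def)
  have "infinite ?L' \<or> k \<le> card ?L'"
  \<comment> \<open>An infinite target fibre qualifies outright; a finite one forces the source to
    be finite, and only then are the two cardinalities meaningful to compare.\<close>
  proof (cases "finite ?L'")
    case True
    then have "finite ?L" "card ?L \<le> card ?L'"
      using inj_on_finite[OF inj lattice_points_translate]
        card_inj_on_le[OF inj lattice_points_translate] by blast+
    with assms show ?thesis by (auto simp: Sg_ge_def)
  qed simp
  with assms show ?thesis by (simp add: Sg_ge_def cone_of_add)
qed

text \<open>The base point \<open>b\<close> is kept general: \<open>b = 0\<close> yields the ideal,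
  and other base points serve the pieces that cover the cone.\<close>

lemma Sg_ge_mono:
  assumes "b + A *v of_nat_vec l \<in> Sg_ge k A" "l \<le> l'"
  shows "b + A *v of_nat_vec l' \<in> Sg_ge k A"
proof -
  have "l' = l + (\<chi> i. l' $ i - l $ i)"
    using assms(2) by (simp add: vec_eq_iff less_eq_vec_def)
  then have "b + A *v of_nat_vec l' =
      (b + A *v of_nat_vec l) + A *v of_nat_vec (\<chi> i. l' $ i - l $ i)"
    by (metis add.assoc matrix_vector_right_distrib of_nat_vec_add)
  then show ?thesis using Sg_ge_add[OF assms(1)] by (simp only:)
qed

text \<open>Subtracting the integer parts of the coefficients of a conic combination leaves a
  lattice point in the image of the unit cube. That image is bounded, so it has finitely many
  lattice points.\<close>

lemma cone_lattice_points_decomposition: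
  fixes A :: "int ^ 'n ^ 'd"
  obtains T where "finite T"
    "{b. of_int_vec b \<in> cone_of A} = (\<Union>t\<in>T. range (\<lambda>l. t + A *v of_nat_vec l))"
proof -
  define T where "T = {t. \<exists>x. of_int_vec t = of_int_mat A *v x \<and> (\<forall>j. 0 \<le> x $ j \<and> x $ j \<le> 1)}"
  \<comment> \<open>The absolute row sum bounds component \<open>i\<close> of the image of the unit
    cube.\<close>
  define B where "B i = (\<Sum>j\<in>UNIV. \<bar>A $ i $ j\<bar>)" for i
  have "T \<subseteq> {t. \<forall>i. t $ i \<in> {- B i..B i}}"
  proof safe
    fix t i assume "t \<in> T"
    then obtain x where x: "of_int_vec t = of_int_mat A *v x" "\<forall>j. 0 \<le> x $ j \<and> x $ j \<le> 1"
      by (auto simp: T_def)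
    have "real_of_int (t $ i) = (\<Sum>j\<in>UNIV. of_int (A $ i $ j) * x $ j)"
      using arg_cong[OF x(1), of "\<lambda>v. v $ i"]
      by (simp add: of_int_vec_def of_int_mat_def matrix_vector_mult_def)
    then have "\<bar>real_of_int (t $ i)\<bar> \<le> (\<Sum>j\<in>UNIV. \<bar>of_int (A $ i $ j) * x $ j\<bar>)"
      by (simp add: sum_abs)
    also have "\<dots> \<le> (\<Sum>j\<in>UNIV. \<bar>of_int (A $ i $ j)\<bar>)"
      using x(2) by (intro sum_mono) (simp add: abs_mult mult_left_le)
    also have "\<dots> = of_int (B i)" by (simp add: B_def)
    finally show "t $ i \<in> {- B i..B i}" by (simp add: abs_le_iff)
  qed
  then have "finite T" by (rule finite_subset) (rule finite_vec_box, simp)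
  moreover have "{b. of_int_vec b \<in> cone_of A} = (\<Union>t\<in>T. range (\<lambda>l. t + A *v of_nat_vec l))"
  proof safe
    fix b assume "of_int_vec b \<in> cone_of A"
    then obtain x where x: "of_int_vec b = of_int_mat A *v x" "\<forall>i. 0 \<le> x $ i"
      by (auto simp: cone_of_def)
    define l where "l = (\<chi> i. nat \<lfloor>x $ i\<rfloor>)"
    have l: "of_int_vec (of_nat_vec l) = (\<chi> i. of_int \<lfloor>x $ i\<rfloor>)"
      using x(2) by (simp add: l_def of_int_vec_def of_nat_vec_def vec_eq_iff)
    have "of_int_vec (b - A *v of_nat_vec l) = of_int_mat A *v (x - of_int_vec (of_nat_vec l))"
      by (simp add: of_int_vec_diff of_int_vec_mult x(1) matrix_vector_mult_diff_distrib)
    moreover have "0 \<le> (x - of_int_vec (of_nat_vec l)) $ j \<and> (x - of_int_vec (of_nat_vec l)) $ j \<le> 1"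
      for j unfolding l by simp linarith
    ultimately have "b - A *v of_nat_vec l \<in> T" unfolding T_def by blast
    moreover have "b = (b - A *v of_nat_vec l) + A *v of_nat_vec l" by simp
    ultimately show "b \<in> (\<Union>t\<in>T. range (\<lambda>l. t + A *v of_nat_vec l))" by blast
  next
    fix t l assume "t \<in> T"
    then show "of_int_vec (t + A *v of_nat_vec l) \<in> cone_of A"
      by (intro cone_of_add) (auto simp: T_def cone_of_def)
  qed
  ultimately show thesis by (rule that)
qed

section \<open>Structure of \<open>Sg_ge\<close> and \<open>Sg_less\<close>\<close>

lemma Sg_less_eq: "Sg_less k A = {b. of_int_vec b \<in> cone_of A} - Sg_ge k A"
  by (auto simp: Sg_less_def Sg_ge_def)

text \<open>For \<open>k \<ge> 1\<close> the fibre over a member of \<open>Sg_ge k A\<close> is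
  nonempty, so the member is attained by a vector of naturals.\<close>

lemma Sg_ge_eq_matrix_image:
  assumes "k \<ge> 1"
  shows "Sg_ge k A = matrix_image A {l. A *v of_nat_vec l \<in> Sg_ge k A}"
proof -
  have "\<exists>l. b = A *v of_nat_vec l" if "b \<in> Sg_ge k A" for b
    using that assms by (subst lattice_points_nonempty_iff[symmetric]) (auto simp: Sg_ge_def)
  then show ?thesis by (auto simp: matrix_image_def)
qed

lemma Sg_less_decomposition:
  fixes A :: "int ^ 'n ^ 'd"
  obtains F :: "((int ^ 'd) \<times> (nat ^ 'n) set) set"
  where "finite F" "\<forall>(t, S)\<in>F. coordinate_subspace S"
    "Sg_less k A = (\<Union>(t, S)\<in>F. (\<lambda>v. t + v) ` matrix_image A S)"
proof -
  obtain T where T: "finite T"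
    "{b. of_int_vec b \<in> cone_of A} = (\<Union>t\<in>T. range (\<lambda>l. t + A *v of_nat_vec l))"
    by (rule cone_lattice_points_decomposition)
  \<comment> \<open>Pulling \<open>Sg_less k A\<close> back along each piece
    \<open>t + A *v of_nat_vec l\<close> of the cover gives a set closed downwards, which can be
    decomposed among the exponent vectors.\<close>
  define D where "D t = {l. t + A *v of_nat_vec l \<notin> Sg_ge k A}" for t
  have "\<exists>G :: ((nat ^ 'n) \<times> (nat ^ 'n) set) set. finite G \<and>
      (\<forall>(u, S)\<in>G. coordinate_subspace S) \<and> D t = (\<Union>(u, S)\<in>G. (+) u ` S)" for t
    by (rule down_closed_decomposition[of "D t"]) (auto simp: D_def dest: Sg_ge_mono)
  then obtain G :: "int ^ 'd \<Rightarrow> ((nat ^ 'n) \<times> (nat ^ 'n) set) set" where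
    G: "\<And>t. finite (G t)" "\<And>t. \<forall>(u, S)\<in>G t. coordinate_subspace S"
      "\<And>t. D t = (\<Union>(u, S)\<in>G t. (+) u ` S)" by metis
  \<comment> \<open>Pushed forward, a translate by \<open>u\<close> of \<open>S\<close> becomes a
    translate by \<open>t + A *v of_nat_vec u\<close> of the image of \<open>S\<close>.\<close>
  define F where "F = (\<Union>t\<in>T. (\<lambda>(u, S). (t + A *v of_nat_vec u, S)) ` G t)"
  have "finite F" using T(1) G(1) by (simp add: F_def)
  moreover have "\<forall>(t, S)\<in>F. coordinate_subspace S" using G(2) by (fastforce simp: F_def)
  moreover have "Sg_less k A = (\<Union>(t, S)\<in>F. (\<lambda>v. t + v) ` matrix_image A S)"
  proof -
    have "Sg_less k A = (\<Union>t\<in>T. (\<lambda>l. t + A *v of_nat_vec l) ` D t)"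
      unfolding Sg_less_eq T(2) by (auto simp: D_def)
    also have "\<dots> = (\<Union>t\<in>T. \<Union>(u, S)\<in>G t. (\<lambda>l. t + A *v of_nat_vec (u + l)) ` S)"
      unfolding G(3) by (simp add: image_UN image_image case_prod_unfold)
    also have "\<dots> = (\<Union>(t, S)\<in>F. (\<lambda>v. t + v) ` matrix_image A S)"
      by (simp add: F_def case_prod_unfold matrix_image_def Setcompr_eq_image image_image
          of_nat_vec_add matrix_vector_right_distrib add.assoc)
    finally show ?thesis .
  qed
  ultimately show thesis by (rule that)
qed

theorem theorem1:
  fixes A :: "int ^ 'n ^ 'd" and k :: nat
  assumes "pointed (cone_of A)" and "k \<ge> 1"
  shows "(\<exists>I :: 'n rat_mpoly set. monomial_ideal I \<and> Sg_ge k A = matrix_image A (exponents I)) \<and>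
    (\<exists>F :: ((int ^ 'd) \<times> (nat ^ 'n) set) set. finite F \<and> (\<forall>(t, S) \<in> F. coordinate_subspace S) \<and>
       Sg_less k A = (\<Union>(t, S) \<in> F. (\<lambda>v. t + v) ` matrix_image A S))"
proof
  \<comment> \<open>All exponents over \<open>Sg_ge k A\<close> serve as generators; as they are
    closed upwards, the ideal they generate has no further exponents.\<close>
  define E where "E = {l. A *v of_nat_vec l \<in> Sg_ge k A}"
  have "exponents (module.span (*) (monomial ` E)) = E"
  proof (rule exponents_span_monomial)
    fix l l' assume "l \<in> E" "l \<le> l'"
    then show "l' \<in> E" using Sg_ge_mono[of 0 A l k l'] by (simp add: E_def)
  qed
  then have "Sg_ge k A = matrix_image A (exponents (module.span (*) (monomial ` E)))"
    using Sg_ge_eq_matrix_image[OF assms(2), of A] by (simp add: E_def)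
  moreover have "monomial_ideal (module.span (*) (monomial ` E))"
    unfolding monomial_ideal_def by blast
  ultimately show "\<exists>I :: 'n rat_mpoly set.
      monomial_ideal I \<and> Sg_ge k A = matrix_image A (exponents I)" by blast
  show "\<exists>F :: ((int ^ 'd) \<times> (nat ^ 'n) set) set. finite F \<and>
      (\<forall>(t, S) \<in> F. coordinate_subspace S) \<and>
      Sg_less k A = (\<Union>(t, S) \<in> F. (\<lambda>v. t + v) ` matrix_image A S)"
    using Sg_less_decomposition[of k A] by metis
qed

end
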